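(* Let $t \geq k \geq 3$ be integers and let $\mathcal{H}$ be a nonempty $k$-uniform hypergraph with degree bound $d$ satisfying $$d \leq \binom{t}{k-1} + \binom{t -\left\lceil \frac{t+1}{k-1}\right\rceil}{k-2} + \binom{t -\left\lceil \frac{2(t+1)}{k-1}\right\rceil}{k-3} + \cdots + \binom{t - \left\lceil \frac{(k-2)(t+1)}{k-1}\right\rceil}{1},$$ that is, $d \leq \sum_{u=0}^{k-2} \binom{t - \lceil u(t+1)/(k-1) \rceil}{k-1-u}$. Then $$\frac{|\sigma(\mathcal{H})|}{|\mathcal{H}|} \geq \frac{k}{t-k+2}.$$
   Context: A $k$-uniform hypergraph on $[n]=\{1,\ldots,n\}$ ($n$ a positive integer) is a family $\mathcal{H} \subset \binom{[n]}{k}$ of $k$-element subsets of $[n]$, called hyperedges; $|\mathcal{H}|$ is the number of hyperedges. The shadow of $\mathcal{H}$ is $\sigma(\mathcal{H}) = \{S \in \binom{[n]}{k-1} : \exists H \in \mathcal{H},\ S \subset H\}$. The maximum degree is $\Delta(\mathcal{H}) = \max_{v \in [n]} |\{H \in \mathcal{H} : v \in H\}|$, and a degree bound of $\mathcal{H}$ is any real number $d$ with $\Delta(\mathcal{H}) \leq d$. Binomial coefficients have nonnegative integer upper entries here, and $\binom{a}{b}=0$ when $0\le a<b$. *)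

theory Defs
  imports Complex_Main
begin

text \<open>Hypergraphs have vertex set \<open>[n] = {1..n}\<close> and are identified with their set of hyperedges.\<close>

definition uniform_hypergraph :: "nat \<Rightarrow> nat \<Rightarrow> nat set set \<Rightarrow> bool" where
  "uniform_hypergraph n k H \<longleftrightarrow> H \<subseteq> {e. e \<subseteq> {1..n} \<and> card e = k}"

definition shadow :: "nat \<Rightarrow> nat \<Rightarrow> nat set set \<Rightarrow> nat set set" where
  "shadow n k H = {S. S \<subseteq> {1..n} \<and> card S = k - 1 \<and> (\<exists>e\<in>H. S \<subseteq> e)}"

text \<open>Well-defined only for \<open>n \<ge> 1\<close>, where the maximum is over a nonempty set.\<close>

definition max_degree :: "nat \<Rightarrow> nat set set \<Rightarrow> nat" where
  "max_degree n H = Max ((\<lambda>v. card {e \<in> H. v \<in> e}) ` {1..n})"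

definition degree_bound :: "nat \<Rightarrow> nat set set \<Rightarrow> real \<Rightarrow> bool" where
  "degree_bound n H d \<longleftrightarrow> real (max_degree n H) \<le> d"

end

theory Submission
  imports Defs
begin

text \<open>
  The link \<open>H\<^sub>v\<close> of a vertex consists of the hyperedges through \<open>v\<close> with \<open>v\<close> removed. The link
  of \<open>v\<close> in the shadow of \<open>H\<close> is the shadow of \<open>H\<^sub>v\<close>, so counting incidences with vertices gives
  \<open>\<Sum>\<^sub>v |H\<^sub>v| = k |H|\<close> and \<open>\<Sum>\<^sub>v |\<sigma>(H\<^sub>v)| = (k - 1) |\<sigma>(H)|\<close>. With \<open>r = k - 1\<close> and
  \<open>N = t + 1\<close> it therefore suffices to show \<open>r |F| \<le> (N - r) |\<sigma>(F)|\<close> for each link \<open>F\<close>, an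
  \<open>r\<close>-uniform family with at most \<open>d\<close> members (\<open>shadow_ratio\<close>). After the substitution
  \<open>j = r - u\<close> the bound on \<open>d\<close> is the sum of \<open>b\<^sub>j choose j\<close> over \<open>1 \<le> j \<le> r\<close>, where
  \<open>b\<^sub>j = \<lfloor>j N / r\<rfloor> - 1\<close>.

  The size of a nonempty family can be written as \<open>1 + \<Sum>\<^sub>j (a\<^sub>j choose j)\<close> with
  \<open>a\<^sub>1 < \<dots> < a\<^sub>r\<close>, and the Kruskal--Katona theorem gives at least \<open>\<Sum>\<^sub>j (a\<^sub>j choose (j - 1))\<close>
  sets in the shadow (\<open>kruskal_katona_cascade\<close>). What remains is an inequality between these two
  sums (\<open>cascade_ratio\<close>). A pair of nonzero terms has the required ratio precisely when
  \<open>a\<^sub>j + 1 \<le> j N / r\<close>, that is, \<open>a\<^sub>j \<le> b\<^sub>j\<close>; this explains the numbers in the degree bound. The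
  sequence \<open>a\<close> lies lexicographically below \<open>b\<close>, when both are read from the top index. While
  \<open>a\<^sub>j = b\<^sub>j\<close> the terms are compared one by one. At the first index \<open>j\<close> with \<open>a\<^sub>j < b\<^sub>j\<close> all
  remaining terms are treated at once: they describe a family of \<open>j\<close>-subsets of a set with \<open>b\<^sub>j\<close>
  elements, for which the ratio is that of the complete family or better
  (\<open>cascade_ratio_below\<close>).
\<close>

section \<open>Shadows, links and shifting\<close>

definition lower_shadow :: "'a set set \<Rightarrow> 'a set set" where
  "lower_shadow F = {A - {x} | A x. A \<in> F \<and> x \<in> A}"

definition link :: "'a \<Rightarrow> 'a set set \<Rightarrow> 'a set set" where
  "link v F = {A. v \<notin> A \<and> insert v A \<in> F}"

definition deletion :: "'a \<Rightarrow> 'a set set \<Rightarrow> 'a set set" where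
  "deletion v F = {A \<in> F. v \<notin> A}"

text \<open>The members of \<open>F\<close> that the shift replacing \<open>j\<close> by \<open>v\<close> really changes.\<close>

definition movable :: "'a \<Rightarrow> 'a \<Rightarrow> 'a set set \<Rightarrow> 'a set set" where
  "movable v j F = {A \<in> F. j \<in> A \<and> v \<notin> A \<and> insert v (A - {j}) \<notin> F}"

definition shift :: "'a \<Rightarrow> 'a \<Rightarrow> 'a set set \<Rightarrow> 'a set set" where
  "shift v j F = (F - movable v j F) \<union> (\<lambda>A. insert v (A - {j})) ` movable v j F"

lemma lower_shadow_iff: "B \<in> lower_shadow F \<longleftrightarrow> (\<exists>x. x \<notin> B \<and> insert x B \<in> F)"
proof
  assume "B \<in> lower_shadow F"
  then obtain A x where "B = A - {x}" "A \<in> F" "x \<in> A" by (auto simp: lower_shadow_def)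
  then show "\<exists>x. x \<notin> B \<and> insert x B \<in> F" by (intro exI[of _ x]) (simp add: insert_absorb)
next
  assume "\<exists>x. x \<notin> B \<and> insert x B \<in> F"
  then obtain x where "x \<notin> B" "insert x B \<in> F" by blast
  then show "B \<in> lower_shadow F" unfolding lower_shadow_def
    by (intro CollectI exI[of _ "insert x B"] exI[of _ x]) auto
qed

text \<open>
  Exchanging \<open>v\<close> and \<open>j\<close> pairs the sets that contain exactly one of them. The shifted family has
  as many members of each pair as before, with the one containing \<open>v\<close> preferred. In this form the
  shift no longer refers to which sets moved, so it can be compared with the shift of the shadow.
\<close>

lemma mem_shift_iff:
  assumes "v \<noteq> j"
  shows "X \<in> shift v j F \<longleftrightarrow>
    (if j \<in> X \<and> v \<notin> X then X \<in> F \<and> insert v (X - {j}) \<in> F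
     else if v \<in> X \<and> j \<notin> X then X \<in> F \<or> insert j (X - {v}) \<in> F
     else X \<in> F)"
proof -
  have image: "X \<in> (\<lambda>A. insert v (A - {j})) ` movable v j F \<longleftrightarrow>
      v \<in> X \<and> j \<notin> X \<and> X \<notin> F \<and> insert j (X - {v}) \<in> F"
  proof
    assume "X \<in> (\<lambda>A. insert v (A - {j})) ` movable v j F"
    then obtain A where A: "A \<in> F" "j \<in> A" "v \<notin> A" "insert v (A - {j}) \<notin> F" "X = insert v (A - {j})"
      by (auto simp: movable_def)
    moreover have "insert j (X - {v}) = A" using A by auto
    ultimately show "v \<in> X \<and> j \<notin> X \<and> X \<notin> F \<and> insert j (X - {v}) \<in> F" using assms by auto
  next
    assume X: "v \<in> X \<and> j \<notin> X \<and> X \<notin> F \<and> insert j (X - {v}) \<in> F"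
    then have "X = insert v (insert j (X - {v}) - {j})" by auto
    then show "X \<in> (\<lambda>A. insert v (A - {j})) ` movable v j F"
      using X assms by (intro image_eqI[where x = "insert j (X - {v})"]) (auto simp: movable_def)
  qed
  show ?thesis unfolding shift_def Un_iff image by (auto simp: movable_def)
qed

lemma movable_inj: "inj_on (\<lambda>A. insert v (A - {j})) (movable v j F)"
proof (rule inj_onI)
  fix A B assume "A \<in> movable v j F" "B \<in> movable v j F" "insert v (A - {j}) = insert v (B - {j})"
  then have "A = insert j (insert v (A - {j}) - {v})" "B = insert j (insert v (B - {j}) - {v})"
    by (auto simp: movable_def)
  then show "A = B" using \<open>insert v (A - {j}) = insert v (B - {j})\<close> by simp
qed

lemma card_shift:
  assumes "finite F"
  shows "card (shift v j F) = card F"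
proof -
  have sub: "movable v j F \<subseteq> F" by (auto simp: movable_def)
  have fin: "finite (movable v j F)" using assms sub by (rule rev_finite_subset)
  have "card (shift v j F) = card (F - movable v j F) + card ((\<lambda>A. insert v (A - {j})) ` movable v j F)"
    unfolding shift_def using assms fin by (intro card_Un_disjoint) (auto simp: movable_def)
  also have "\<dots> = card F"
    using card_image[OF movable_inj[of v j F]] card_Diff_subset[OF fin sub] card_mono[OF assms sub] by simp
  finally show ?thesis .
qed

lemma card_deletion_shift:
  assumes "finite F" "movable v j F \<noteq> {}"
  shows "card (deletion v (shift v j F)) < card (deletion v F)"
proof (rule psubset_card_mono)
  show "finite (deletion v F)" using assms by (auto simp: deletion_def)
  show "deletion v (shift v j F) \<subset> deletion v F"
    using assms(2) by (auto simp: deletion_def shift_def movable_def)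
qed

text \<open>
  Shifting does not enlarge the shadow, since the shifted shadow is as large as the original one.
  Let \<open>B\<close> arise by removing \<open>x\<close> from a member \<open>X\<close> of the shifted family. If \<open>x\<close> is neither \<open>v\<close>
  nor \<open>j\<close>, removing \<open>x\<close> commutes with exchanging \<open>v\<close> and \<open>j\<close>. If \<open>x\<close> is one of them and \<open>X\<close>
  contains both, the partner of \<open>B\<close> is \<open>X\<close> without the other one. If \<open>X\<close> contains only \<open>x\<close> of the
  two, \<open>B\<close> contains neither and is its own partner.
\<close>

lemma lower_shadow_shift:
  assumes "v \<noteq> j"
  shows "lower_shadow (shift v j F) \<subseteq> shift v j (lower_shadow F)"
proof
  fix B assume "B \<in> lower_shadow (shift v j F)"
  then obtain x where x: "x \<notin> B" "insert x B \<in> shift v j F" by (auto simp: lower_shadow_iff)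
  show "B \<in> shift v j (lower_shadow F)"
  proof (cases "x = v \<or> x = j")
    case True
    have "insert v (insert j B - {j}) = insert v B" if "j \<notin> B" using that by auto
    moreover have "insert j (insert v B - {v}) = insert j B" if "v \<notin> B" using that by auto
    moreover have "insert j (insert v (B - {j})) = insert v B" if "j \<in> B" using that assms by auto
    moreover have "insert v (insert j (B - {v})) = insert j B" if "v \<in> B" using that assms by auto
    ultimately show ?thesis using x assms True
      unfolding mem_shift_iff[OF assms] lower_shadow_iff
      by (smt (verit, ccfv_threshold) insert_iff Diff_iff insert_commute)
  next
    case False
    have "insert v (insert x B - {j}) = insert x (insert v (B - {j}))"
      "insert j (insert x B - {v}) = insert x (insert j (B - {v}))" using False by auto
    then show ?thesis using x False
      unfolding mem_shift_iff[OF assms] lower_shadow_iff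
      by (smt (verit, ccfv_threshold) insert_iff Diff_iff)
  qed
qed


lemma link_deletion_finite:
  assumes "finite F"
  shows "finite (link v F)" "finite (deletion v F)"
proof -
  have "inj_on (insert v) (link v F)" by (auto simp: inj_on_def link_def)
  moreover have "insert v ` link v F \<subseteq> F" by (auto simp: link_def)
  ultimately show "finite (link v F)" using assms by (meson finite_imageD finite_subset)
  show "finite (deletion v F)" using assms by (auto simp: deletion_def)
qed

lemma card_link: "card (link v F) = card {A \<in> F. v \<in> A}"
proof (rule bij_betw_same_card[of "insert v"])
  have "A \<in> insert v ` link v F" if "A \<in> F" "v \<in> A" for A
    using that by (intro image_eqI[of _ _ "A - {v}"]) (auto simp: link_def insert_absorb)
  then show "bij_betw (insert v) (link v F) {A \<in> F. v \<in> A}"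
    by (auto simp: bij_betw_def inj_on_def link_def insert_ident)
qed

lemma card_link_deletion:
  assumes "finite F"
  shows "card F = card (link v F) + card (deletion v F)"
proof -
  have "F = {A \<in> F. v \<in> A} \<union> deletion v F" by (auto simp: deletion_def)
  then have "card F = card ({A \<in> F. v \<in> A} \<union> deletion v F)" by simp
  also have "\<dots> = card {A \<in> F. v \<in> A} + card (deletion v F)"
    using assms by (intro card_Un_disjoint) (auto simp: deletion_def)
  finally show ?thesis by (simp add: card_link)
qed

lemma finite_lower_shadow:
  assumes "finite F" "\<And>A. A \<in> F \<Longrightarrow> finite A"
  shows "finite (lower_shadow F)"
proof -
  have "lower_shadow F \<subseteq> (\<Union>A\<in>F. Pow A)" by (auto simp: lower_shadow_def)
  then show ?thesis using assms by (auto intro: finite_subset)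
qed

lemma link_lower_shadow: "link v (lower_shadow F) = lower_shadow (link v F)"
  by (auto simp: link_def lower_shadow_iff insert_commute)

lemma link_subset_lower_shadow: "link v F \<subseteq> deletion v (lower_shadow F)"
  by (auto simp: link_def deletion_def lower_shadow_iff)

text \<open>
  The members of the link are the shadow sets obtained by removing \<open>v\<close>; the shadow of the link
  accounts for the shadow sets that contain \<open>v\<close>.
\<close>

lemma card_lower_shadow_ge:
  assumes "finite F" "\<And>A. A \<in> F \<Longrightarrow> finite A"
  shows "card (link v F) + card (lower_shadow (link v F)) \<le> card (lower_shadow F)"
proof -
  have fin: "finite (lower_shadow F)" by (rule finite_lower_shadow[OF assms])
  have "card (link v F) \<le> card (deletion v (lower_shadow F))"
    using link_deletion_finite(2)[OF fin] link_subset_lower_shadow by (rule card_mono)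
  then show ?thesis using card_link_deletion[OF fin, of v] by (simp add: link_lower_shadow)
qed

text \<open>
  Shifting towards \<open>v\<close> lowers the number of members avoiding \<open>v\<close>, so a family minimising this
  number is stable under all shifts towards \<open>v\<close>. For such a family, removing \<open>x\<close> from a member
  that avoids \<open>v\<close> leaves a set to which \<open>v\<close> can be added.
\<close>

lemma exists_shifted:
  fixes F :: "'a set set"
  assumes "finite V" "v \<in> V" "F \<subseteq> {A. A \<subseteq> V \<and> card A = s}"
  obtains G where "G \<subseteq> {A. A \<subseteq> V \<and> card A = s}" "card G = card F"
    "card (lower_shadow G) \<le> card (lower_shadow F)"
    "lower_shadow (deletion v G) \<subseteq> link v G"
proof -
  define P where "P G \<longleftrightarrow> G \<subseteq> {A. A \<subseteq> V \<and> card A = s} \<and> card G = card F \<and>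
    card (lower_shadow G) \<le> card (lower_shadow F)" for G :: "'a set set"
  have "P F" using assms(3) by (simp add: P_def)
  then obtain G where "P G" and least: "\<And>G'. P G' \<Longrightarrow> card (deletion v G) \<le> card (deletion v G')"
    using ex_has_least_nat[of P F "\<lambda>G. card (deletion v G)"] by blast
  have G: "G \<subseteq> {A. A \<subseteq> V \<and> card A = s}" using \<open>P G\<close> by (simp add: P_def)
  have finsets: "finite A" if "A \<in> G" for A using that G assms(1) by (auto intro: finite_subset)
  have "finite {A. A \<subseteq> V \<and> card A = s}" using assms(1) by simp
  with G have finG: "finite G" by (rule finite_subset)
  have stable: "movable v j G = {}" if "j \<in> V" "j \<noteq> v" for j
  proof (rule ccontr)
    assume "movable v j G \<noteq> {}"
    then have "card (deletion v (shift v j G)) < card (deletion v G)"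
      by (rule card_deletion_shift[OF finG])
    moreover have "P (shift v j G)" unfolding P_def
    proof (intro conjI)
      have "card (insert v (A - {j})) = s \<and> insert v (A - {j}) \<subseteq> V" if "A \<in> movable v j G" for A
      proof -
        have A: "A \<in> G" "j \<in> A" "v \<notin> A" using that by (auto simp: movable_def)
        then have "card (insert v (A - {j})) = card A" using finsets[of A]
          by (metis Diff_iff card.remove card_insert_disjoint finite_Diff)
        then show ?thesis using A G assms(2) by auto
      qed
      then show "shift v j G \<subseteq> {A. A \<subseteq> V \<and> card A = s}" using G by (auto simp: shift_def)
      show "card (shift v j G) = card F" using card_shift[OF finG] \<open>P G\<close> by (simp add: P_def)
      have fin: "finite (lower_shadow G)" using finG finsets by (rule finite_lower_shadow)
      have "card (lower_shadow (shift v j G)) \<le> card (shift v j (lower_shadow G))"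
      proof (rule card_mono)
        show "finite (shift v j (lower_shadow G))"
          using fin by (simp add: shift_def movable_def)
        show "lower_shadow (shift v j G) \<subseteq> shift v j (lower_shadow G)"
          using that by (intro lower_shadow_shift) simp
      qed
      also have "\<dots> \<le> card (lower_shadow F)" using card_shift[OF fin] \<open>P G\<close> by (simp add: P_def)
      finally show "card (lower_shadow (shift v j G)) \<le> card (lower_shadow F)" .
    qed
    ultimately show False using least by fastforce
  qed
  have "lower_shadow (deletion v G) \<subseteq> link v G"
  proof
    fix B assume "B \<in> lower_shadow (deletion v G)"
    then obtain x where x: "x \<notin> B" "insert x B \<in> G" "v \<notin> insert x B"
      by (auto simp: lower_shadow_iff deletion_def)
    moreover have "insert x B \<notin> movable v x G" using stable[of x] x G by auto
    ultimately show "B \<in> link v G" by (auto simp: movable_def link_def)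
  qed
  then show ?thesis using \<open>P G\<close> by (intro that) (simp_all add: P_def)
qed



section \<open>Sums of binomial coefficients along increasing sequences\<close>

text \<open>
  The indices start at 0, so \<open>a j\<close> is the upper entry of the term with lower entry \<open>j + 1\<close>. For
  increasing \<open>a\<close>, \<open>cascade a s\<close> is the rank of the set of values of \<open>a\<close> in the colexicographic
  order of all \<open>s\<close>-sets of natural numbers. The terms with \<open>a j = j\<close>, which are 0, are allowed;
  thus for positive \<open>s\<close> every number has such a representation with exactly \<open>s\<close> terms.
\<close>

definition cascade :: "(nat \<Rightarrow> nat) \<Rightarrow> nat \<Rightarrow> nat" where
  "cascade a s = (\<Sum>j<s. a j choose Suc j)"

text \<open>
  The size of the shadow of the colexicographic initial segment with \<open>cascade a s + 1\<close> members;
  its term at \<open>j = 0\<close> is always 1, and this accounts for the additional member.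
\<close>

definition cascade_shadow :: "(nat \<Rightarrow> nat) \<Rightarrow> nat \<Rightarrow> nat" where
  "cascade_shadow a s = (\<Sum>j<s. a j choose j)"

lemma cascade_less_choose:
  assumes "strict_mono_on {..<s} a" "\<And>j. j < s \<Longrightarrow> a j < x"
  shows "cascade a s < x choose s"
  using assms
proof (induction s arbitrary: x)
  case 0
  then show ?case by (simp add: cascade_def)
next
  case (Suc s)
  have "cascade a s < a s choose s"
    using Suc.prems(1) by (intro Suc.IH) (auto simp: strict_mono_on_def)
  then have "cascade a (Suc s) < Suc (a s) choose Suc s" by (simp add: cascade_def)
  also have "\<dots> \<le> x choose Suc s" using Suc.prems(2)[of s] by (intro binomial_right_mono) simp
  finally show ?case .
qed

lemma strict_mono_on_ge:
  assumes "strict_mono_on {..<s} a" "j < s"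
  shows "j \<le> (a j :: nat)"
  using assms(2)
proof (induction j)
  case (Suc j)
  moreover have "a j < a (Suc j)" using assms(1) Suc.prems by (auto simp: strict_mono_on_def)
  ultimately show ?case by simp
qed simp

text \<open>
  The greedy expansion: the largest \<open>x\<close> with \<open>x choose s \<le> m\<close> leaves a remainder below
  \<open>x choose (s - 1)\<close>, which forces the later entries to be smaller than \<open>x\<close>. For \<open>s = 0\<close> only the
  number 0 is represented.
\<close>

lemma cascade_exists:
  "\<exists>a. strict_mono_on {..<s} a \<and> cascade a s = (if s = 0 then 0 else m)"
proof (induction s arbitrary: m)
  case 0
  then show ?case by (auto simp: cascade_def strict_mono_on_def)
next
  case (Suc s)
  define P where "P x \<longleftrightarrow> x choose Suc s \<le> m" for x
  have bound: "x \<le> m + s" if "P x" for x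
  proof (rule ccontr)
    assume "\<not> x \<le> m + s"
    then have "Suc m + s choose Suc s \<le> x choose Suc s" by (intro binomial_right_mono) simp
    moreover have "Suc m \<le> Suc m + s choose Suc s"
    proof (induction s)
      case (Suc s)
      then show ?case by simp
    qed simp
    ultimately show False using that by (simp add: P_def)
  qed
  define x where "x = (GREATEST x. P x)"
  have "P 0" by (simp add: P_def)
  then have Px: "P x" unfolding x_def using bound by (rule GreatestI_nat)
  have "y \<le> x" if "P y" for y unfolding x_def using that bound by (rule Greatest_le_nat)
  then have "\<not> P (Suc x)" by fastforce
  then have up: "m - (x choose Suc s) < x choose s" using Px by (simp add: P_def)
  obtain a where a: "strict_mono_on {..<s} a"
    "cascade a s = (if s = 0 then 0 else m - (x choose Suc s))" using Suc.IH by blast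
  have less: "a j < x" if "j < s" for j
  proof (rule ccontr)
    assume "\<not> a j < x"
    moreover have "a j \<le> a (s - 1)"
      using a(1) that by (cases "j = s - 1") (auto simp: strict_mono_on_def less_imp_le)
    ultimately have "x choose s \<le> a (s - 1) choose s" by (intro binomial_right_mono) simp
    also have "\<dots> \<le> cascade a s"
      using that unfolding cascade_def
      by (cases s) auto
    finally show False using a(2) up that by simp
  qed
  have "strict_mono_on {..<Suc s} (a(s := x))"
    using a(1) less by (auto simp: strict_mono_on_def less_Suc_eq)
  moreover have "cascade (a(s := x)) (Suc s) = m"
  proof -
    have "cascade (a(s := x)) (Suc s) = cascade a s + (x choose Suc s)"
      by (simp add: cascade_def)
    moreover have "s = 0 \<Longrightarrow> m - (x choose Suc s) = 0" using up by simp
    ultimately show ?thesis using a(2) Px by (auto simp: P_def)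
  qed
  ultimately show ?case by auto
qed

lemma choose_shadow_ratio: "Suc j * (x choose Suc j) = (x - j) * (x choose j)"
  by (cases x) (simp_all only: Suc_times_binomial binomial_absorb_comp diff_Suc_1 binomial_0_Suc diff_0_eq_0 mult_0 mult_0_right)

text \<open>
  This is the local LYM inequality for initial segments inside a set with \<open>t\<close> elements, proved on
  the level of numbers. The top entry \<open>x\<close> contributes the complete family on \<open>x\<close> points, and the
  remainder \<open>R\<close> has the ratio that belongs to \<open>x\<close> in place of \<open>t\<close>. The defect \<open>R\<close> left by
  replacing \<open>s\<close> with \<open>s + 1\<close> is paid for by \<open>R \<le> x choose s\<close>.
\<close>

lemma cascade_ratio_below:
  assumes "strict_mono_on {..<s} a" "\<And>j. j < s \<Longrightarrow> a j < t"
  shows "s * Suc (cascade a s) \<le> (Suc t - s) * cascade_shadow a s"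
  using assms
proof (induction s arbitrary: t)
  case (Suc s)
  define x where "x = a s"
  define R where "R = Suc (cascade a s)"
  define R' where "R' = cascade_shadow a s"
  have mono: "strict_mono_on {..<s} a" "\<And>j. j < s \<Longrightarrow> a j < x"
    using Suc.prems(1) by (auto simp: strict_mono_on_def x_def)
  have IH: "s * R \<le> (Suc x - s) * R'" using Suc.IH[OF mono] by (simp add: R_def R'_def)
  have R: "R \<le> x choose s" using cascade_less_choose[OF mono] by (simp add: R_def)
  have "s \<le> x" using strict_mono_on_ge[OF Suc.prems(1), of s] by (simp add: x_def)
  have "x < t" using Suc.prems(2) by (simp add: x_def)
  have "Suc s * Suc (cascade a (Suc s)) = Suc s * (x choose Suc s) + s * R + R"
    by (simp add: cascade_def R_def x_def algebra_simps)
  also have "\<dots> \<le> (x - s) * (x choose s) + (Suc x - s) * R' + (x choose s)"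
    using IH R choose_shadow_ratio[of s x] by simp
  also have "\<dots> = (Suc x - s) * ((x choose s) + R')"
    using \<open>s \<le> x\<close> by (simp add: Suc_diff_le add_mult_distrib add_mult_distrib2 del: mult_Suc_right)
  also have "\<dots> \<le> (Suc t - Suc s) * ((x choose s) + R')"
    using \<open>x < t\<close> by (intro mult_right_mono) auto
  finally show ?case by (simp add: cascade_shadow_def R'_def x_def add.commute)
qed simp

text \<open>
  The top entry \<open>a s\<close> cannot exceed \<open>b s\<close>: then its term alone would be larger than the whole
  cascade of \<open>b\<close>. If it equals \<open>b s\<close>, its term has the required ratio and is removed together with
  that of \<open>b\<close>. If it is smaller, the preceding lemma with \<open>t = b s\<close> applies to everything. The
  numbers \<open>r\<close> and \<open>N\<close> enter only through the quotient \<open>N / r\<close> and stay fixed when \<open>s\<close> decreases.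
\<close>

lemma cascade_ratio:
  fixes N r s :: nat
  defines "b \<equiv> \<lambda>j. Suc j * N div r - 1"
  assumes "0 < r" "r \<le> N" "strict_mono_on {..<s} a" "cascade a s < cascade b s"
  shows "r * Suc (cascade a s) \<le> (N - r) * cascade_shadow a s"
proof -
  have mono: "strict_mono b"
  proof (rule strict_mono_Suc_iff[THEN iffD2], rule allI)
    fix j
    have "Suc (Suc j * N div r) = (Suc j * N + r) div r" using assms(2) by simp
    also have "\<dots> \<le> Suc (Suc j) * N div r" using assms(3) by (intro div_le_mono) simp
    finally have "Suc (Suc j * N div r) \<le> Suc (Suc j) * N div r" .
    moreover have "1 \<le> Suc j * N div r"
      using assms(2,3) by (simp add: Suc_le_eq div_greater_zero_iff trans_le_add1)
    ultimately show "b j < b (Suc j)" unfolding b_def by linarith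
  qed
  show ?thesis using assms(4,5)
  proof (induction s)
    case 0
    then show ?case by (simp add: cascade_def)
  next
    case (Suc s)
    have below: "strict_mono_on {..<s} a" "\<And>j. j < s \<Longrightarrow> a j < a s"
      using Suc.prems(1) by (auto simp: strict_mono_on_def)
    have pos: "1 \<le> Suc s * N div r"
      using assms(2,3) by (simp add: Suc_le_eq div_greater_zero_iff trans_le_add1)
    have "r * Suc (b s) \<le> Suc s * N"
      using pos unfolding b_def by simp
    then have quot: "r * (Suc (b s) - Suc s) \<le> Suc s * (N - r)"
      by (simp add: diff_mult_distrib2 algebra_simps)
    have "a s \<le> b s"
    proof (rule ccontr)
      assume "\<not> a s \<le> b s"
      then have "Suc (b s) choose Suc s \<le> a s choose Suc s" by (intro binomial_right_mono) simp
      then have "cascade b (Suc s) < cascade a (Suc s)"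
        using cascade_less_choose[of s b "b s"] mono
        by (simp add: cascade_def strict_mono_on_def strict_mono_def)
      then show False using Suc.prems(2) by simp
    qed
    then consider "a s < b s" | "a s = b s" by linarith
    then show ?case
    proof cases
      case 1
      then have "\<And>j. j < Suc s \<Longrightarrow> a j < b s" using below(2) by (auto simp: less_Suc_eq intro: less_trans)
      then have "Suc s * Suc (cascade a (Suc s)) \<le> (Suc (b s) - Suc s) * cascade_shadow a (Suc s)"
        using cascade_ratio_below Suc.prems(1) by blast
      then have "r * (Suc s * Suc (cascade a (Suc s))) \<le> r * ((Suc (b s) - Suc s) * cascade_shadow a (Suc s))"
        by (rule mult_left_mono) simp
      also have "\<dots> \<le> (Suc s * (N - r)) * cascade_shadow a (Suc s)"
        using mult_right_mono[OF quot, of "cascade_shadow a (Suc s)"] by (simp only: mult.assoc)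
      finally have "Suc s * (r * Suc (cascade a (Suc s))) \<le> Suc s * ((N - r) * cascade_shadow a (Suc s))"
        by (simp only: ac_simps)
      then show ?thesis by (simp only: Suc_mult_le_cancel1)
    next
      case 2
      have "Suc s * (r * (a s choose Suc s)) = r * ((a s - s) * (a s choose s))"
        using choose_shadow_ratio[of s "a s"] by (metis mult.left_commute)
      also have "\<dots> \<le> (Suc s * (N - r)) * (a s choose s)"
        using mult_right_mono[OF quot, of "a s choose s"] 2 by (simp only: mult.assoc diff_Suc_Suc)
      finally have "Suc s * (r * (a s choose Suc s)) \<le> Suc s * ((N - r) * (a s choose s))"
        by (simp only: ac_simps)
      then have "r * (a s choose Suc s) \<le> (N - r) * (a s choose s)"
        by (simp only: Suc_mult_le_cancel1)
      moreover have "r * Suc (cascade a s) \<le> (N - r) * cascade_shadow a s"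
        using Suc.IH below(1) Suc.prems(2) 2 by (simp add: cascade_def)
      ultimately show ?thesis by (simp add: cascade_def cascade_shadow_def algebra_simps)
    qed
  qed
qed


section \<open>The Kruskal--Katona theorem\<close>

text \<open>
  Frankl's argument. After shifting towards \<open>v\<close>, the shadow of the members avoiding \<open>v\<close> is
  contained in the link of \<open>v\<close>. Pascal's rule splits the cascade of \<open>a\<close> into parts for the link
  and for the deletion. If the link is large, its members and their shadow already give the bound.
  Otherwise the deletion exceeds its part, and by induction its shadow is too large to fit into the
  link.
\<close>

theorem kruskal_katona_cascade:
  assumes "finite V" "F \<subseteq> {A. A \<subseteq> V \<and> card A = s}"
    "strict_mono_on {..<s} a" "cascade a s < card F"
  shows "cascade_shadow a s \<le> card (lower_shadow F)"
  using assms
proof (induction V arbitrary: F s a rule: finite_induct)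
  case empty
  show ?case
  proof (cases s)
    case (Suc s')
    then have "F = {}" using empty.prems(1) by auto
    then show ?thesis using empty.prems(3) by simp
  qed (simp add: cascade_shadow_def)
next
  case (insert v V)
  show ?case
  proof (cases s)
    case 0
    then show ?thesis by (simp add: cascade_shadow_def)
  next
    case (Suc r)
    obtain G where G: "G \<subseteq> {A. A \<subseteq> insert v V \<and> card A = s}" "card G = card F"
      "card (lower_shadow G) \<le> card (lower_shadow F)" "lower_shadow (deletion v G) \<subseteq> link v G"
      using exists_shifted[OF _ _ insert.prems(1), of v] insert.hyps(1) by blast
    have finsets: "finite A" if "A \<in> G" for A using that G(1) insert.hyps(1) by (auto intro: finite_subset)
    have "finite {A. A \<subseteq> insert v V \<and> card A = s}" using insert.hyps(1) by simp
    with G(1) have finG: "finite G" by (rule finite_subset)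
    have linkG: "link v G \<subseteq> {A. A \<subseteq> V \<and> card A = r}"
    proof
      fix A assume "A \<in> link v G"
      then have A: "v \<notin> A" "insert v A \<in> G" by (auto simp: link_def)
      then show "A \<in> {A. A \<subseteq> V \<and> card A = r}" using G(1) finsets[OF A(2)] Suc by auto
    qed
    have delG: "deletion v G \<subseteq> {A. A \<subseteq> V \<and> card A = s}" using G(1) by (auto simp: deletion_def)
    \<comment> \<open>\<open>c\<close> and \<open>b\<close> are the sequences for the link and for the deletion. In \<open>b\<close>, entries with
      \<open>a j = j\<close> cannot be lowered without violating \<open>j \<le> b j\<close>; keeping them does not change the
      cascade, since their terms are 0, and it can only increase the shadow.\<close>
    define c where "c j = a (Suc j) - 1" for j
    define b where "b j = max (a j - 1) j" for j
    have ge: "j \<le> a j" if "j < s" for j using strict_mono_on_ge[OF insert.prems(2) that] .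
    have less: "a i < a j" if "i < j" "j < s" for i j
      using insert.prems(2) that by (auto simp: strict_mono_on_def)
    have c_mono: "strict_mono_on {..<r} c"
    proof (rule strict_mono_onI)
      fix i j assume "i \<in> {..<r}" "j \<in> {..<r}" "i < j"
      then show "c i < c j" using less[of "Suc i" "Suc j"] ge[of "Suc i"] Suc by (simp add: c_def)
    qed
    have b_mono: "strict_mono_on {..<s} b"
    proof (rule strict_mono_onI)
      fix i j assume "i \<in> {..<s}" "j \<in> {..<s}" "i < j"
      then show "b i < b j" using less[of i j] ge[of i] by (auto simp: b_def)
    qed
    have pascal: "a (Suc j) choose Suc i = (c j choose i) + (c j choose Suc i)" if "j < r" for i j
      using ge[of "Suc j"] that Suc by (cases "a (Suc j)") (auto simp: c_def)
    have shadow_sum: "cascade_shadow a s = Suc (cascade c r + cascade_shadow c r)"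
      unfolding Suc cascade_shadow_def cascade_def sum.lessThan_Suc_shift
      by (simp add: pascal sum.distrib)
    show ?thesis
    proof (cases "cascade c r < card (link v G)")
      case True
      have "cascade_shadow c r \<le> card (lower_shadow (link v G))"
        by (rule insert.IH[OF linkG c_mono True])
      then have "cascade_shadow a s \<le> card (link v G) + card (lower_shadow (link v G))"
        using True shadow_sum by simp
      also have "\<dots> \<le> card (lower_shadow G)" by (rule card_lower_shadow_ge[OF finG finsets])
      finally show ?thesis using G(3) by simp
    next
      case False
      have "cascade b s + cascade c r \<le> cascade a s"
      proof -
        have "b (Suc j) choose Suc (Suc j) \<le> c j choose Suc (Suc j)" for j
        proof (cases "Suc j \<le> c j")
          case True
          then show ?thesis by (simp add: b_def c_def)
        next
          case False
          then have "b (Suc j) = Suc j" by (simp add: b_def c_def)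
          then show ?thesis by (simp add: binomial_eq_0 del: binomial_Suc_Suc)
        qed
        then have "cascade b s \<le> b 0 + (\<Sum>j<r. c j choose Suc (Suc j))"
          unfolding Suc cascade_def sum.lessThan_Suc_shift by (simp add: sum_mono)
        moreover have "cascade a s = a 0 + (cascade c r + (\<Sum>j<r. c j choose Suc (Suc j)))"
          unfolding Suc cascade_def sum.lessThan_Suc_shift by (simp add: pascal sum.distrib)
        ultimately show ?thesis by (simp add: b_def)
      qed
      then have "cascade b s < card (deletion v G)"
        using False insert.prems(3) G(2) card_link_deletion[OF finG, of v] by simp
      then have "cascade_shadow b s \<le> card (lower_shadow (deletion v G))"
        by (rule insert.IH[OF delG b_mono])
      also have "\<dots> \<le> card (link v G)"
        using link_deletion_finite(1)[OF finG] G(4) by (rule card_mono)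
      also have "\<dots> \<le> cascade c r" using False by simp
      also have "\<dots> < cascade_shadow b s"
      proof -
        have "c j choose Suc j \<le> b (Suc j) choose Suc j" for j
          by (rule binomial_right_mono) (simp add: b_def c_def)
        then show ?thesis
          unfolding Suc cascade_def cascade_shadow_def sum.lessThan_Suc_shift
          by (simp add: less_Suc_eq_le sum_mono)
      qed
      finally show ?thesis by simp
    qed
  qed
qed

section \<open>From links to the hypergraph\<close>

lemma shadow_ratio:
  fixes N r :: nat
  assumes "finite V" "F \<subseteq> {A. A \<subseteq> V \<and> card A = r}" "0 < r" "r \<le> N"
    "card F \<le> (\<Sum>j<r. (Suc j * N div r - 1) choose Suc j)"
  shows "r * card F \<le> (N - r) * card (lower_shadow F)"
proof (cases "card F")
  case (Suc m)
  obtain a where a: "strict_mono_on {..<r} a" "cascade a r = m"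
    using cascade_exists[of r m] assms(3) by auto
  have "r * Suc (cascade a r) \<le> (N - r) * cascade_shadow a r"
    using assms(3-5) a Suc by (intro cascade_ratio) (simp_all add: cascade_def)
  also have "\<dots> \<le> (N - r) * card (lower_shadow F)"
    using kruskal_katona_cascade[OF assms(1,2) a(1)] a(2) Suc by simp
  finally show ?thesis using a(2) Suc by simp
qed simp

lemma sum_card_link:
  assumes "finite V" "F \<subseteq> {A. A \<subseteq> V \<and> card A = s}"
  shows "(\<Sum>v\<in>V. card (link v F)) = s * card F"
proof -
  have "finite {A. A \<subseteq> V \<and> card A = s}" using assms(1) by simp
  with assms(2) have fin: "finite F" by (rule finite_subset)
  have "V \<inter> A = A" if "A \<in> F" for A using that assms(2) by auto
  then show ?thesis unfolding card_link using assms fin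
    by (intro sum_multicount) (auto simp: Int_def[symmetric] Collect_conj_eq)
qed

lemma shadow_eq_lower_shadow:
  assumes "uniform_hypergraph n k H" "0 < k"
  shows "shadow n k H = lower_shadow H"
proof (intro set_eqI iffI)
  fix S assume "S \<in> shadow n k H"
  then obtain e where S: "S \<subseteq> e" "e \<in> H" "card S = k - 1" by (auto simp: shadow_def)
  have e: "card e = k" "finite e"
    using S(2) assms(1) by (auto simp: uniform_hypergraph_def intro: finite_subset)
  then have "card (e - S) = 1" using S assms(2) finite_subset[OF S(1)] by (simp add: card_Diff_subset)
  then obtain x where "e - S = {x}" by (auto simp: card_1_singleton_iff)
  then have "S = e - {x}" "x \<in> e" using S(1) by auto
  then show "S \<in> lower_shadow H" using S(2) by (auto simp: lower_shadow_def)
next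
  fix S assume "S \<in> lower_shadow H"
  then obtain e x where e: "S = e - {x}" "e \<in> H" "x \<in> e" by (auto simp: lower_shadow_def)
  moreover have "e \<subseteq> {1..n}" "card e = k" "finite e"
    using e(2) assms(1) by (auto simp: uniform_hypergraph_def intro: finite_subset)
  ultimately show "S \<in> shadow n k H" by (auto simp: shadow_def)
qed

lemma ceiling_floor_complement:
  fixes M r u j :: nat
  assumes "0 < r" "u + j = r"
  shows "M - nat \<lceil>real u * real M / real r\<rceil> = j * M div r"
proof -
  have "real u * real M / real r = real M - real (j * M) / real r"
  proof -
    have u: "real u = real r - real j" using assms(2) by simp
    show ?thesis unfolding u using assms(1) by (simp add: left_diff_distrib diff_divide_distrib)
  qed
  then have "\<lceil>real u * real M / real r\<rceil> = int M - \<lfloor>real (j * M) / real r\<rfloor>"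
    by linarith
  also have "\<lfloor>real (j * M) / real r\<rfloor> = int (j * M div r)"
    by (metis floor_divide_of_nat_eq)
  finally have "\<lceil>real u * real M / real r\<rceil> = int M - int (j * M div r)" .
  moreover have "j * M div r \<le> M" 
    using assms by (metis div_le_mono le_add2 mult_le_mono1 nonzero_mult_div_cancel_left not_gr_zero)
  ultimately show ?thesis by simp
qed

theorem theorem1p5:
  fixes n k t :: nat and H :: "nat set set" and d :: real
  assumes "n \<ge> 1" and "k \<ge> 3" and "t \<ge> k"
    and "uniform_hypergraph n k H" and "H \<noteq> {}"
    and "degree_bound n H d"
    and "d \<le> (\<Sum>u = 0..k - 2.
           real ((t - nat \<lceil>real u * (real t + 1) / (real k - 1)\<rceil>) choose (k - 1 - u)))"
  shows "real (card (shadow n k H)) / real (card H) \<ge> real k / (real t - real k + 2)"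
proof -
  define r where "r = k - 1"
  define N where "N = Suc t"
  have r: "0 < r" "r < N" "k = Suc r" using assms(2,3) by (auto simp: r_def N_def)
  have H: "H \<subseteq> {A. A \<subseteq> {1..n} \<and> card A = k}" using assms(4) by (simp add: uniform_hypergraph_def)
  have "finite {A. A \<subseteq> {1..n} \<and> card A = k}" by simp
  with H have finH: "finite H" by (rule finite_subset)
  \<comment> \<open>The summand with index \<open>u\<close> has lower entry \<open>r - u\<close>, which is \<open>Suc j\<close> for \<open>j = r - Suc u\<close>.\<close>
  have "(\<Sum>u = 0..k - 2. real ((t - nat \<lceil>real u * (real t + 1) / (real k - 1)\<rceil>) choose (k - 1 - u)))
      = (\<Sum>j<r. real ((Suc j * N div r - 1) choose Suc j))"
  proof (rule sum.reindex_bij_witness[of _ "\<lambda>j. r - Suc j" "\<lambda>u. r - Suc u"])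
    fix u assume "u \<in> {0..k - 2}"
    then have u: "u < r" using r assms(2) by auto
    have "N - nat \<lceil>real u * real N / real r\<rceil> = Suc (r - Suc u) * N div r"
      using u r(1) by (intro ceiling_floor_complement) auto
    then have "t - nat \<lceil>real u * (real t + 1) / (real k - 1)\<rceil> = Suc (r - Suc u) * N div r - 1"
      using r by (simp add: N_def add.commute)
    moreover have "k - 1 - u = Suc (r - Suc u)" using u r by simp
    ultimately show "real ((Suc (r - Suc u) * N div r - 1) choose Suc (r - Suc u)) =
      real ((t - nat \<lceil>real u * (real t + 1) / (real k - 1)\<rceil>) choose (k - 1 - u))" by simp
  qed (use r assms(2) in auto)
  then have "real (max_degree n H) \<le> real (\<Sum>j<r. (Suc j * N div r - 1) choose Suc j)"
    using assms(6,7) by (simp add: degree_bound_def)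
  then have deg: "max_degree n H \<le> (\<Sum>j<r. (Suc j * N div r - 1) choose Suc j)"
    by (simp only: of_nat_le_iff)
  have local: "r * card (link v H) \<le> (N - r) * card (link v (lower_shadow H))" if "v \<in> {1..n}" for v
    unfolding link_lower_shadow
  proof (rule shadow_ratio)
    show "link v H \<subseteq> {A. A \<subseteq> {1..n} \<and> card A = r}"
    proof
      fix A assume "A \<in> link v H"
      then have A: "v \<notin> A" "insert v A \<subseteq> {1..n}" "card (insert v A) = k" using H by (auto simp: link_def)
      moreover have "finite A" using A(2) by (auto intro: finite_subset)
      ultimately show "A \<in> {A. A \<subseteq> {1..n} \<and> card A = r}" using r by auto
    qed
    have "card (link v H) \<le> max_degree n H"
      unfolding card_link max_degree_def using that by (intro Max_ge) auto
    then show "card (link v H) \<le> (\<Sum>j<r. (Suc j * N div r - 1) choose Suc j)" using deg by simp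
  qed (use r in auto)
  have shadow: "lower_shadow H \<subseteq> {A. A \<subseteq> {1..n} \<and> card A = r}"
    using shadow_eq_lower_shadow[OF assms(4)] r by (auto simp: shadow_def)
  have "r * (k * card H) = (\<Sum>v\<in>{1..n}. r * card (link v H))"
    using sum_card_link[OF _ H] by (simp flip: sum_distrib_left)
  also have "\<dots> \<le> (\<Sum>v\<in>{1..n}. (N - r) * card (link v (lower_shadow H)))"
    using local by (rule sum_mono)
  also have "\<dots> = r * ((N - r) * card (lower_shadow H))"
    using sum_card_link[OF _ shadow] by (simp flip: sum_distrib_left)
  finally have "k * card H \<le> (N - r) * card (shadow n k H)"
    using r shadow_eq_lower_shadow[OF assms(4)] by simp
  then have "real k * real (card H) \<le> real (N - r) * real (card (shadow n k H))"
    by (simp only: flip: of_nat_mult of_nat_le_iff)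
  moreover have "real (N - r) = real t - real k + 2" using r by (simp add: N_def of_nat_diff)
  moreover have "0 < card H" using finH assms(5) by (simp add: card_gt_0_iff)
  moreover have "0 < real t - real k + 2" using assms(3) by simp
  ultimately show ?thesis by (simp add: field_simps)
qed

end
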